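(* Let $n\ge 1$ and let $G=K_{n+1}$ be the complete graph with $n+1$ vertices. If $C$ is a nice $n$-edge-colouring of $G$, then $G$ has at least $\lceil \frac{n+1}{2}\rceil\lfloor\frac{n+1}{2}\rfloor$ different heterochromatic spanning trees.
   Context: An $n$-edge-colouring of $K_{n+1}$ is a partition of its edge set into $n$ colour classes; it is called nice if the $n$ colour classes have sizes $1,2,\ldots,n$. A subgraph is heterochromatic if all its edges have different colours. *)

theory Defs
  imports Complex_Main "HOL-Library.Disjoint_Sets" "HOL-Library.Ramsey"
begin

text \<open>
  A simple graph is given by a vertex set \<open>V\<close> and a set \<open>E\<close> of two-element subsets of \<open>V\<close>.
  The complete graph on \<open>V\<close> has edge set \<open>[V]\<^bsup>2\<^esup>\<close>.
  A spanning subgraph keeps all of \<open>V\<close>, so it is identified with its edge set.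
\<close>

definition complete_edges :: "'a set \<Rightarrow> 'a set set" where
  "complete_edges V = [V]\<^bsup>2\<^esup>"

definition connected_graph :: "'a set \<Rightarrow> 'a set set \<Rightarrow> bool" where
  "connected_graph V E \<longleftrightarrow>
     V \<noteq> {} \<and> (\<forall>u\<in>V. \<forall>v\<in>V. (u, v) \<in> {(x, y). {x, y} \<in> E}\<^sup>*)"

text \<open>
  The list \<open>xs\<close> does not repeat its first vertex at the end. Length at least 3 is needed
  because otherwise traversing a single edge back and forth would count as a cycle.
\<close>

definition graph_cycle :: "'a set set \<Rightarrow> 'a list \<Rightarrow> bool" where
  "graph_cycle E xs \<longleftrightarrow>
     length xs \<ge> 3 \<and> distinct xs \<and>
     successively (\<lambda>x y. {x, y} \<in> E) xs \<and> {last xs, hd xs} \<in> E"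

definition tree_graph :: "'a set \<Rightarrow> 'a set set \<Rightarrow> bool" where
  "tree_graph V E \<longleftrightarrow> connected_graph V E \<and> (\<nexists>xs. graph_cycle E xs)"

definition spanning_tree :: "'a set \<Rightarrow> 'a set set \<Rightarrow> 'a set set \<Rightarrow> bool" where
  "spanning_tree V E T \<longleftrightarrow> T \<subseteq> E \<and> tree_graph V T"

text \<open>A colouring is the set of its colour classes; \<open>partition_on\<close> makes each class nonempty.\<close>

definition edge_colouring :: "nat \<Rightarrow> 'a set set \<Rightarrow> 'a set set set \<Rightarrow> bool" where
  "edge_colouring n E C \<longleftrightarrow> partition_on E C \<and> finite C \<and> card C = n"

definition nice_colouring :: "nat \<Rightarrow> 'a set set \<Rightarrow> 'a set set set \<Rightarrow> bool" where
  "nice_colouring n E C \<longleftrightarrow> edge_colouring n E C \<and> bij_betw card C {1..n}"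

definition heterochromatic :: "'a set set set \<Rightarrow> 'a set set \<Rightarrow> bool" where
  "heterochromatic C F \<longleftrightarrow>
     (\<forall>e\<in>F. \<forall>f\<in>F. e \<noteq> f \<longrightarrow> (\<nexists>c. c \<in> C \<and> e \<in> c \<and> f \<in> c))"

end

theory Submission
  imports Defs
begin

text \<open>
  Delete one edge from each colour class of size at least 2. Any \<open>k\<close> remaining classes together
  still have more than \<open>k choose 2\<close> edges, hence rank at least \<open>k\<close> in the graphic matroid, so
  Rado's theorem yields a heterochromatic spanning tree avoiding all deleted edges.
  Now let an adversary delete edges. In the classes of sizes \<open>2, \<dots>, q\<close> it deletes the edge
  contained in most of the surviving trees; a fraction of at most
  \<open>(1/2) (2/3) \<dots> ((q-1)/q) = 1/q\<close> of the \<open>N\<close> trees survives. In each of the other \<open>n - q\<close>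
  classes it kills one more tree. As some tree must survive, \<open>N \<ge> q (n + 1 - q)\<close>, and
  \<open>q = \<lceil>(n + 1)/2\<rceil>\<close> gives the bound.
\<close>

subsection \<open>Rado's theorem\<close>

text \<open>Shrink the sets while keeping the rank condition: a set with two distinct elements can
  always lose one of them. Once all sets are singletons, the condition for \<open>J = I\<close> is
  the conclusion.\<close>

lemma rado:
  fixes r :: "'b set \<Rightarrow> nat"
  assumes submod: "\<And>X Y. X \<subseteq> E \<Longrightarrow> Y \<subseteq> E \<Longrightarrow> r (X \<union> Y) + r (X \<inter> Y) \<le> r X + r Y"
    and mono: "\<And>X Y. X \<subseteq> Y \<Longrightarrow> Y \<subseteq> E \<Longrightarrow> r X \<le> r Y"
    and empty: "r {} = 0"
    and "finite I"
    and "\<And>i. i \<in> I \<Longrightarrow> A i \<subseteq> E" "\<And>i. i \<in> I \<Longrightarrow> finite (A i)"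
    and "\<And>J. J \<subseteq> I \<Longrightarrow> card J \<le> r (\<Union> (A ` J))"
  shows "\<exists>t. (\<forall>i\<in>I. t i \<in> A i) \<and> card I \<le> r (t ` I)"
  using assms(5-)
proof (induction "\<Sum>i\<in>I. card (A i)" arbitrary: A rule: less_induct)
  case less
  note sub = less.prems(1) and fin = less.prems(2) and rado = less.prems(3)
  have nonempty: "A i \<noteq> {}" if "i \<in> I" for i
    using rado[of "{i}"] that empty by auto
  show ?case
  proof (cases "\<forall>i\<in>I. \<exists>x. A i = {x}")
    case True
    then obtain t where t: "\<And>i. i \<in> I \<Longrightarrow> A i = {t i}" by metis
    then have "\<Union> (A ` I) = t ` I" by auto
    with rado[of I] t show ?thesis by auto
  next
    case False
    then obtain i x y where i: "i \<in> I" and xy: "x \<in> A i" "y \<in> A i" "x \<noteq> y"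
      using nonempty by blast
    define D where "D z = A(i := A i - {z})" for z
    have "\<exists>z\<in>{x, y}. \<forall>J\<subseteq>I. card J \<le> r (\<Union> (D z ` J))"
    proof (rule ccontr)
      assume neg: "\<not> ?thesis"
      \<comment> \<open>A violating family must contain \<open>i\<close>, since only
        \<open>A i\<close> was changed. Splitting off \<open>i\<close> turns \<open><\<close> into
        \<open>\<le>\<close>.\<close>
      have *: "\<exists>J. J \<subseteq> I - {i} \<and> r (\<Union> (A ` J) \<union> (A i - {z})) \<le> card J" if "z \<in> {x, y}" for z
      proof -
        from neg that obtain K where K: "K \<subseteq> I" "r (\<Union> (D z ` K)) < card K"
          by (meson not_less)
        have "i \<in> K"
        proof (rule ccontr)
          assume "i \<notin> K"
          then have "D z ` K = A ` K" by (auto simp: D_def)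
          with K rado show False by (metis not_less)
        qed
        have "\<Union> (D z ` K) = \<Union> (A ` (K - {i})) \<union> (A i - {z})"
          using \<open>i \<in> K\<close> by (auto simp: D_def split: if_splits)
        moreover have "card K = Suc (card (K - {i}))"
          using \<open>i \<in> K\<close> K(1) \<open>finite I\<close> by (metis card_Suc_Diff1 finite_subset)
        ultimately show ?thesis using K by (intro exI[of _ "K - {i}"]) auto
      qed
      obtain J where J: "J \<subseteq> I - {i}" "r (\<Union> (A ` J) \<union> (A i - {x})) \<le> card J"
        using *[of x] by auto
      obtain K where K: "K \<subseteq> I - {i}" "r (\<Union> (A ` K) \<union> (A i - {y})) \<le> card K"
        using *[of y] by auto
      let ?X = "\<Union> (A ` J) \<union> (A i - {x})" and ?Y = "\<Union> (A ` K) \<union> (A i - {y})"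
      have E: "?X \<subseteq> E" "?Y \<subseteq> E" using J K sub i by blast+
      have fJK: "finite J" "finite K" using J K \<open>finite I\<close> by (auto intro: finite_subset)
      \<comment> \<open>As \<open>x \<noteq> y\<close>, the union recovers all of
        \<open>A i\<close>. The rank condition thus bounds the rank of the union below by
        \<open>card (J \<union> K) + 1\<close> and that of the intersection by
        \<open>card (J \<inter> K)\<close>; by submodularity the sum is at most
        \<open>card J + card K\<close>, one too little.\<close>
      have "?X \<union> ?Y = \<Union> (A ` insert i (J \<union> K))" using xy by auto
      moreover have "insert i (J \<union> K) \<subseteq> I" using J K i by auto
      ultimately have "card (insert i (J \<union> K)) \<le> r (?X \<union> ?Y)"
        using rado[of "insert i (J \<union> K)"] by metis
      moreover have "i \<notin> J \<union> K" using J K by auto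
      ultimately have 1: "Suc (card (J \<union> K)) \<le> r (?X \<union> ?Y)" using fJK by simp
      have "card (J \<inter> K) \<le> r (\<Union> (A ` (J \<inter> K)))" using J by (intro rado) auto
      also have "\<dots> \<le> r (?X \<inter> ?Y)" using E by (intro mono) auto
      finally have "Suc (card (J \<union> K) + card (J \<inter> K)) \<le> r ?X + r ?Y"
        using 1 submod[OF E] by linarith
      then show False using J K card_Un_Int[OF fJK] by linarith
    qed
    then obtain z where z: "z \<in> A i" and Dz: "\<And>J. J \<subseteq> I \<Longrightarrow> card J \<le> r (\<Union> (D z ` J))"
      using xy by blast
    have Dsub: "D z j \<subseteq> A j" for j by (auto simp: D_def)
    have "(\<Sum>j\<in>I. card (D z j)) < (\<Sum>j\<in>I. card (A j))"
    proof (rule sum_strict_mono_ex1[OF \<open>finite I\<close>])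
      show "\<forall>j\<in>I. card (D z j) \<le> card (A j)" using Dsub fin by (auto intro: card_mono)
      have "card (D z i) < card (A i)"
        using card_Diff1_less[OF fin[OF i] z] by (simp only: D_def fun_upd_same)
      with i show "\<exists>j\<in>I. card (D z j) < card (A j)" by blast
    qed
    from less.hyps[OF this] have "\<exists>t. (\<forall>j\<in>I. t j \<in> D z j) \<and> card I \<le> r (t ` I)"
      using Dsub sub fin Dz by (meson finite_subset subset_trans)
    with Dsub show ?thesis by blast
  qed
qed

subsection \<open>The rank function of the graphic matroid\<close>

definition conn :: "'a set set \<Rightarrow> ('a \<times> 'a) set" where
  "conn F = {(x, y). {x, y} \<in> F}\<^sup>*"

definition comps :: "'a set \<Rightarrow> 'a set set \<Rightarrow> 'a set set" where
  "comps V F = (\<lambda>x. conn F `` {x}) ` V"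

text \<open>This is the rank in the graphic matroid, that is, the size of a spanning forest. For
  finite \<open>V\<close> the subtraction does not truncate, by
  \<open>card_comps_le\<close>.\<close>

definition grank :: "'a set \<Rightarrow> 'a set set \<Rightarrow> nat" where
  "grank V F = card V - card (comps V F)"

lemma equiv_conn: "equiv UNIV (conn F)"
proof (rule equivI)
  have "sym {(x, y). {x, y} \<in> F}" by (auto simp: sym_def insert_commute)
  then show "sym (conn F)" unfolding conn_def by (rule sym_rtrancl)
qed (auto simp: conn_def refl_rtrancl trans_rtrancl)

lemma conn_sym: "(x, y) \<in> conn F \<longleftrightarrow> (y, x) \<in> conn F"
  using equiv_conn[of F] by (meson equiv_def symD)

lemma conn_trans: "(x, y) \<in> conn F \<Longrightarrow> (y, z) \<in> conn F \<Longrightarrow> (x, z) \<in> conn F"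
  by (simp add: conn_def)

lemma conn_refl [simp]: "(x, x) \<in> conn F"
  by (simp add: conn_def)

lemma conn_mono: "F \<subseteq> G \<Longrightarrow> conn F \<subseteq> conn G"
  unfolding conn_def by (rule rtrancl_mono) auto

lemma conn_class_eq_iff: "conn F `` {x} = conn F `` {y} \<longleftrightarrow> (x, y) \<in> conn F"
  by (rule eq_equiv_class_iff[OF equiv_conn UNIV_I UNIV_I])

text \<open>A walk can be shortened so that it uses the new edge at most once, in one of its two
  directions.\<close>

lemma conn_insert:
  "conn (insert {u, v} F) =
     conn F \<union> {(x, y). (x, u) \<in> conn F \<and> (v, y) \<in> conn F}
            \<union> {(x, y). (x, v) \<in> conn F \<and> (u, y) \<in> conn F}"
proof -
  have "{(x, y). {x, y} \<in> insert {u, v} F} = insert (u, v) (insert (v, u) {(x, y). {x, y} \<in> F})"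
    by (auto simp: doubleton_eq_iff)
  then have "conn (insert {u, v} F) = (insert (u, v) (insert (v, u) {(x, y). {x, y} \<in> F}))\<^sup>*"
    by (simp add: conn_def)
  also have "\<dots> = conn F \<union> {(x, y). (x, u) \<in> conn F \<and> (v, y) \<in> conn F}
            \<union> {(x, y). (x, v) \<in> conn F \<and> (u, y) \<in> conn F}"
    unfolding rtrancl_insert conn_def[symmetric]
    by (auto intro: conn_trans)
  finally show ?thesis .
qed

lemma conn_insert_redundant: "(u, v) \<in> conn F \<Longrightarrow> conn (insert {u, v} F) = conn F"
  unfolding conn_insert by (auto; metis conn_sym conn_trans)

text \<open>The new edge merges the classes of its two ends and leaves every other class as it
  is.\<close>

lemma card_comps_insert:
  assumes "finite V" "u \<in> V" "v \<in> V" "(u, v) \<notin> conn F"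
  shows "card (comps V F) = Suc (card (comps V (insert {u, v} F)))"
proof -
  let ?c = "\<lambda>x. conn F `` {x}" and ?d = "\<lambda>x. conn (insert {u, v} F) `` {x}"
  let ?U = "?c u" and ?W = "?c v"
  have d: "?d x = (if x \<in> ?U \<union> ?W then ?U \<union> ?W else ?c x)" for x
    using conn_sym[of _ _ F] conn_trans[of _ _ F] unfolding conn_insert by auto
  have c: "?c x \<in> {?U, ?W} \<longleftrightarrow> x \<in> ?U \<union> ?W" for x
    using conn_class_eq_iff[of F] conn_sym[of _ _ F] by auto
  have "comps V (insert {u, v} F) = insert (?U \<union> ?W) (comps V F - {?U, ?W})"
  proof (intro equalityI subsetI)
    fix X assume "X \<in> comps V (insert {u, v} F)"
    then obtain x where "x \<in> V" "X = ?d x" by (auto simp: comps_def)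
    then show "X \<in> insert (?U \<union> ?W) (comps V F - {?U, ?W})"
      using c[of x] d[of x] by (auto simp: comps_def)
  next
    fix X assume X: "X \<in> insert (?U \<union> ?W) (comps V F - {?U, ?W})"
    show "X \<in> comps V (insert {u, v} F)"
    proof (cases "X = ?U \<union> ?W")
      case True
      then have "X = ?d u" using d[of u] by simp
      then show ?thesis using assms by (auto simp: comps_def)
    next
      case False
      then obtain x where "x \<in> V" "X = ?c x" "?c x \<notin> {?U, ?W}" using X by (auto simp: comps_def)
      then have "X = ?d x" using c[of x] d[of x] by simp
      then show ?thesis using \<open>x \<in> V\<close> by (auto simp: comps_def)
    qed
  qed
  \<comment> \<open>Otherwise the count would drop by two and not by one.\<close>
  moreover have "?U \<union> ?W \<notin> comps V F - {?U, ?W}"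
  proof
    assume "?U \<union> ?W \<in> comps V F - {?U, ?W}"
    then obtain x where x: "?c x = ?U \<union> ?W" "?c x \<notin> {?U, ?W}" by (auto simp: comps_def)
    have "x \<in> ?c x" by simp
    with x c[of x] show False by blast
  qed
  moreover have "finite (comps V F)" "{?U, ?W} \<subseteq> comps V F" "card {?U, ?W} = 2"
    using assms conn_class_eq_iff[of F u v] by (auto simp: comps_def)
  moreover from this have "card (comps V F - {?U, ?W}) = card (comps V F) - 2" "2 \<le> card (comps V F)"
    by (metis card_Diff_subset finite.emptyI finite_insert, metis card_mono)
  ultimately show ?thesis by simp
qed

lemma card_comps_le: "finite V \<Longrightarrow> card (comps V F) \<le> card V"
  unfolding comps_def by (rule card_image_le)

section \<open>Matroid axioms for the graphic rank\<close>

lemma grank_insert: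
  assumes "finite V" "u \<in> V" "v \<in> V"
  shows "grank V (insert {u, v} F) = (if (u, v) \<in> conn F then grank V F else Suc (grank V F))"
  using card_comps_insert[OF assms, of F] card_comps_le[OF assms(1), of F]
  by (auto simp: grank_def comps_def conn_insert_redundant)

lemma grank_empty [simp]: "grank V {} = 0"
proof -
  have "conn {} = (Id :: ('a \<times> 'a) set)" by (simp add: conn_def)
  then have "comps V {} = (\<lambda>x. {x}) ` V" by (auto simp: comps_def)
  then show ?thesis by (simp add: grank_def card_image)
qed

lemma nsets_2_cases:
  assumes "e \<in> [V]\<^bsup>2\<^esup>"
  obtains u v where "e = {u, v}" "u \<in> V" "v \<in> V" "u \<noteq> v"
  using assms by (auto simp: nsets_def card_2_iff)

text \<open>Diminishing returns, edge by edge: an edge raises the rank iff its ends are not yet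
  connected, and ends not connected in the larger graph are not connected in the smaller
  one.\<close>

lemma grank_Un_diminishing:
  assumes "finite V" "finite D" "D \<subseteq> [V]\<^bsup>2\<^esup>" "F \<subseteq> G"
  shows "grank V (G \<union> D) + grank V F \<le> grank V G + grank V (F \<union> D)"
  using assms(2,3)
proof (induction D rule: finite_induct)
  case (insert e D)
  then obtain u v where e: "e = {u, v}" "u \<in> V" "v \<in> V" by (auto elim: nsets_2_cases)
  have "conn (F \<union> D) \<subseteq> conn (G \<union> D)" using assms(4) by (intro conn_mono) auto
  then have "(u, v) \<in> conn (F \<union> D) \<Longrightarrow> (u, v) \<in> conn (G \<union> D)" by blast
  with insert.IH insert.prems show ?case
    by (simp add: e grank_insert[OF assms(1) e(2,3)])
qed simp

lemma grank_submodular: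
  assumes "finite V" "F \<subseteq> [V]\<^bsup>2\<^esup>" "G \<subseteq> [V]\<^bsup>2\<^esup>"
  shows "grank V (F \<union> G) + grank V (F \<inter> G) \<le> grank V F + grank V G"
proof -
  have "finite G" using assms finite_subset finite_imp_finite_nsets by metis
  then show ?thesis
    using grank_Un_diminishing[OF assms(1) _ assms(3), of "F \<inter> G" F] by (simp add: Int_absorb1 Un_absorb1 sup.absorb2)
qed

lemma grank_mono:
  assumes "finite V" "F \<subseteq> G" "G \<subseteq> [V]\<^bsup>2\<^esup>"
  shows "grank V F \<le> grank V G"
proof -
  \<comment> \<open>Saturating under \<open>conn G\<close> maps the components of \<open>F\<close>
    onto those of \<open>G\<close>, so there are at most as many of the latter.\<close>
  have "comps V G = (\<lambda>X. conn G `` X) ` comps V F"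
  proof -
    have "conn G `` (conn F `` {x}) = conn G `` {x}" for x
      using conn_mono[OF assms(2)] conn_trans[of _ _ G] by (auto intro: conn_refl)
    then show ?thesis by (auto simp: comps_def image_image)
  qed
  then have "card (comps V G) \<le> card (comps V F)"
    using assms(1) by (simp add: card_image_le comps_def)
  then show ?thesis by (simp add: grank_def)
qed

lemma grank_le_card:
  assumes "finite V" "finite F" "F \<subseteq> [V]\<^bsup>2\<^esup>"
  shows "grank V F \<le> card F"
  using assms(2,3)
proof (induction F rule: finite_induct)
  case (insert e F)
  then obtain u v where e: "e = {u, v}" "u \<in> V" "v \<in> V" by (auto elim: nsets_2_cases)
  with insert grank_insert[OF assms(1) e(2,3), of F] show ?case by auto
qed simp

section \<open>Bounding the number of edges by the rank\<close>

lemma sum_pronic_le: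
  fixes d :: "'b \<Rightarrow> nat"
  assumes "finite S"
  shows "(\<Sum>s\<in>S. d s * (d s + 1)) \<le> (\<Sum>s\<in>S. d s) * ((\<Sum>s\<in>S. d s) + 1)"
  using assms
proof (induction S rule: finite_induct)
  case (insert s S)
  let ?D = "\<Sum>s\<in>S. d s"
  have "d s * (d s + 1) + ?D * (?D + 1) \<le> (d s + ?D) * (d s + ?D + 1)"
    by (simp add: algebra_simps)
  with insert show ?case by simp
qed simp

text \<open>A component with \<open>d + 1\<close> vertices contributes \<open>d\<close> to the rank
  and has at most \<open>d * (d + 1) / 2\<close> edges. By superadditivity of
  \<open>d * (d + 1)\<close>, the bound is largest when a single component carries all the rank.
  Everything is doubled to avoid division.\<close>

lemma card_le_choose_grank:
  assumes "finite V" "F \<subseteq> [V]\<^bsup>2\<^esup>"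
  shows "card F \<le> (grank V F + 1) choose 2"
proof -
  have finC: "finite (comps V F)" using assms by (simp add: comps_def)
  have Vsub: "x \<in> V \<Longrightarrow> y \<in> V" if "(x, y) \<in> conn F" for x y
    using that unfolding conn_def
    by (induction rule: rtrancl_induct) (use assms(2) in \<open>auto simp: nsets_def\<close>)
  then have KV: "K \<subseteq> V" if "K \<in> comps V F" for K using that by (auto simp: comps_def)
  then have finK: "finite K" if "K \<in> comps V F" for K using that assms finite_subset by metis
  have neK: "K \<noteq> {}" if "K \<in> comps V F" for K
    using that unfolding comps_def using conn_refl by fast
  have VU: "\<Union> (comps V F) = V"
    using KV conn_refl[of _ F] unfolding comps_def by blast
  have disj: "disjoint (comps V F)"
  proof (rule disjointI)
    fix X Y assume "X \<in> comps V F" "Y \<in> comps V F" "X \<noteq> Y"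
    moreover have "comps V F \<subseteq> UNIV // conn F" by (auto simp: comps_def quotient_def)
    ultimately show "X \<inter> Y = {}"
      using quotient_disj[OF equiv_conn[of F]] by blast
  qed
  have "F \<subseteq> (\<Union>K\<in>comps V F. [K]\<^bsup>2\<^esup>)"
  proof
    fix e assume "e \<in> F"
    with assms(2) obtain u v where e: "e = {u, v}" "u \<in> V" "v \<in> V" "u \<noteq> v"
      by (meson nsets_2_cases subsetD)
    then have "(u, v) \<in> conn F" using \<open>e \<in> F\<close> by (auto simp: conn_def)
    then have "e \<in> [conn F `` {u}]\<^bsup>2\<^esup>" using e by (auto simp: nsets_def)
    then show "e \<in> (\<Union>K\<in>comps V F. [K]\<^bsup>2\<^esup>)" using e(2) unfolding comps_def by blast
  qed
  then have "card F \<le> card (\<Union>K\<in>comps V F. [K]\<^bsup>2\<^esup>)"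
    using finC finK by (intro card_mono) (auto intro: finite_imp_finite_nsets)
  also have "\<dots> \<le> (\<Sum>K\<in>comps V F. card ([K]\<^bsup>2\<^esup>))" by (rule card_UN_le[OF finC])
  also have "\<dots> = (\<Sum>K\<in>comps V F. card K choose 2)" by simp
  finally have "2 * card F \<le> (\<Sum>K\<in>comps V F. 2 * (card K choose 2))"
    by (simp add: sum_distrib_left[symmetric])
  also have "\<dots> = (\<Sum>K\<in>comps V F. (card K - 1) * ((card K - 1) + 1))"
  proof (rule sum.cong[OF refl])
    fix K assume K: "K \<in> comps V F"
    then have "card K > 0" using finK neK by (simp add: card_gt_0_iff)
    then show "2 * (card K choose 2) = (card K - 1) * ((card K - 1) + 1)"
      by (simp add: choose_two)
  qed
  also have "\<dots> \<le> (\<Sum>K\<in>comps V F. card K - 1) * ((\<Sum>K\<in>comps V F. card K - 1) + 1)"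
    by (rule sum_pronic_le[OF finC])
  also have "(\<Sum>K\<in>comps V F. card K - 1) = grank V F"
  proof -
    \<comment> \<open>Natural subtraction commutes with the sum only because every component is
      nonempty.\<close>
    have "(\<Sum>K\<in>comps V F. card K - 1) = (\<Sum>K\<in>comps V F. card K) - (\<Sum>K\<in>comps V F. 1)"
    proof (rule sum_subtractf_nat)
      fix K assume "K \<in> comps V F"
      then show "1 \<le> card K" using finK neK by (simp add: Suc_le_eq card_gt_0_iff)
    qed
    moreover have "card V = (\<Sum>K\<in>comps V F. card K)"
      using card_Union_disjoint[of "comps V F"] disj finK VU
      by (simp add: pairwise_def disjnt_def disjoint_def)
    ultimately show ?thesis by (simp add: grank_def)
  qed
  finally show ?thesis by (simp add: choose_two)
qed

text \<open>Full rank leaves a single component. On a cycle, the closing edge could be dropped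
  without loss of rank, leaving fewer than \<open>n\<close> edges of rank at least
  \<open>n\<close>.\<close>

lemma spanning_tree_if_grank:
  assumes "finite V" "card V = n + 1" "T \<subseteq> [V]\<^bsup>2\<^esup>" "card T \<le> n" "n \<le> grank V T"
  shows "spanning_tree V ([V]\<^bsup>2\<^esup>) T"
proof -
  have finT: "finite T" using assms finite_subset finite_imp_finite_nsets by metis
  have "V \<noteq> {}" using assms by auto
  have c1: "card (comps V T) \<le> 1" using assms(2,5) card_comps_le[OF assms(1), of T] unfolding grank_def by arith
  have "(u, v) \<in> conn T" if "u \<in> V" "v \<in> V" for u v
  proof -
    have "conn T `` {u} \<in> comps V T" "conn T `` {v} \<in> comps V T" using that by (auto simp: comps_def)
    moreover have "finite (comps V T)" using assms by (simp add: comps_def)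
    ultimately have "conn T `` {u} = conn T `` {v}"
      using c1 card_le_Suc0_iff_eq by (metis One_nat_def)
    then show ?thesis by (simp add: conn_class_eq_iff)
  qed
  then have "connected_graph V T"
    using \<open>V \<noteq> {}\<close> by (auto simp: connected_graph_def conn_def)
  moreover have False if cyc: "graph_cycle T xs" for xs
  proof -
    let ?u = "last xs" and ?v = "hd xs"
    let ?T = "T - {{?u, ?v}}"
    have xs: "length xs \<ge> 3" "distinct xs" "successively (\<lambda>x y. {x, y} \<in> T) xs" "{?u, ?v} \<in> T"
      using cyc by (auto simp: graph_cycle_def)
    then have ne: "xs \<noteq> []" by auto
    \<comment> \<open>No other edge of the cycle is the closing edge: equality of the index pairs
      would force length 2, which \<open>length xs \<ge> 3\<close> excludes.\<close>
    have step: "{xs ! i, xs ! Suc i} \<in> ?T" if "Suc i < length xs" for i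
    proof -
      have "{xs ! i, xs ! Suc i} \<in> T" using xs(3) that by (simp add: successively_conv_nth)
      moreover have "{xs ! i, xs ! Suc i} \<noteq> {xs ! (length xs - 1), xs ! 0}"
      proof
        assume "{xs ! i, xs ! Suc i} = {xs ! (length xs - 1), xs ! 0}"
        then have "(!) xs ` {i, Suc i} = (!) xs ` {length xs - 1, 0}" by simp
        then have "{i, Suc i} = {length xs - 1, 0}"
          using inj_on_image_eq_iff[OF inj_on_nth[OF xs(2), of "{..<length xs}"],
              of "{i, Suc i}" "{length xs - 1, 0}"] that ne
          by (simp del: image_insert)
        then show False using xs(1) by (auto simp: doubleton_eq_iff)
      qed
      ultimately show ?thesis using ne by (simp add: last_conv_nth hd_conv_nth)
    qed
    have "(xs ! 0, xs ! i) \<in> conn ?T" if "i < length xs" for i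
      using that
    proof (induction i)
      case (Suc i)
      then have "(xs ! i, xs ! Suc i) \<in> conn ?T" using step[of i] by (auto simp: conn_def)
      with Suc show ?case by (auto intro: conn_trans)
    qed simp
    from this[of "length xs - 1"] have "(?u, ?v) \<in> conn ?T"
      using ne by (simp add: last_conv_nth hd_conv_nth conn_sym)
    moreover have "insert {?u, ?v} ?T = T" using xs(4) by auto
    moreover have "?u \<in> V" "?v \<in> V" using xs(4) assms(3) by (auto simp: nsets_def)
    ultimately have "grank V T = grank V ?T"
      using grank_insert[OF assms(1), of ?u ?v ?T] by simp
    also have "\<dots> \<le> card ?T" using assms finT by (intro grank_le_card) auto
    also have "\<dots> < card T" using finT xs(4) by (rule card_Diff1_less)
    finally show False using assms by linarith
  qed
  ultimately show ?thesis using assms(3) by (auto simp: spanning_tree_def tree_graph_def)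
qed

subsection \<open>Rainbow trees avoiding one edge of each colour\<close>

text \<open>Here \<open>max 1 (s - 1)\<close> is what a class of size \<open>s\<close> retains when
  one edge is deleted from it unless it is a singleton. The sets \<open>{1..k}\<close> with
  \<open>k \<ge> 1\<close> are extremal: their sum exceeds \<open>k choose 2\<close> by exactly
  one.\<close>

lemma choose_two_less_sum:
  assumes "finite S" "S \<noteq> {}" "0 \<notin> S"
  shows "card S choose 2 < (\<Sum>s\<in>S. max 1 (s - 1))"
  using assms
proof (induction "card S" arbitrary: S)
  case (Suc k)
  let ?m = "Max S"
  let ?S = "S - {?m}"
  have m: "?m \<in> S" using Suc.prems by simp
  \<comment> \<open>The maximum of \<open>k + 1\<close> distinct positive integers is at least
    \<open>k + 1\<close>, so its term is at least \<open>k\<close>, the increment of the binomial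
    coefficient.\<close>
  have "S \<subseteq> {1..?m}" using Suc.prems by (auto simp: Suc_le_eq intro: gr0I)
  from card_mono[OF _ this] have km: "Suc k \<le> ?m" using Suc.hyps(2) by simp
  have sum: "(\<Sum>s\<in>S. max 1 (s - 1)) = max 1 (?m - 1) + (\<Sum>s\<in>?S. max 1 (s - 1))"
    by (rule sum.remove[OF Suc.prems(1) m])
  have card: "card ?S = k" using m Suc.hyps(2) Suc.prems(1) by simp
  show ?case
  proof (cases "?S = {}")
    case True
    then have "k = 0" using card by (metis card.empty)
    with sum True show ?thesis by (simp flip: Suc.hyps(2) add: numeral_2_eq_2)
  next
    case False
    with Suc.hyps(1)[of ?S] card Suc.prems have "k choose 2 < (\<Sum>s\<in>?S. max 1 (s - 1))" by simp
    moreover have "Suc k choose 2 = k + (k choose 2)" by (simp add: numeral_2_eq_2)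
    ultimately show ?thesis using km sum Suc.hyps(2) by simp
  qed
qed simp

text \<open>The function \<open>x\<close> names the deleted edges. A singleton class must keep its
  only edge, so \<open>x\<close> is ignored there. That the tree meets every class is recorded for
  the averaging argument of the adversary.\<close>

lemma rainbow_tree_avoiding:
  assumes V: "finite V" "card V = n + 1"
    and nice: "nice_colouring n (complete_edges V) C"
    and x: "\<And>c. c \<in> C \<Longrightarrow> x c \<in> c"
  shows "\<exists>T. spanning_tree V (complete_edges V) T \<and> heterochromatic C T \<and>
      (\<forall>c\<in>C. T \<inter> c \<noteq> {}) \<and> (\<forall>c\<in>C. card c \<noteq> 1 \<longrightarrow> x c \<notin> T)"
proof -
  let ?E = "[V]\<^bsup>2\<^esup>"
  have part: "partition_on ?E C" and finC: "finite C" and cardC: "card C = n"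
    and bij: "bij_betw card C {1..n}"
    using nice by (auto simp: nice_colouring_def edge_colouring_def complete_edges_def)
  have finE: "finite ?E" using V by (simp add: finite_imp_finite_nsets)
  have sub: "c \<subseteq> ?E" if "c \<in> C" for c using part that by (auto simp: partition_on_def)
  have disj: "c \<inter> d = {}" if "c \<in> C" "d \<in> C" "c \<noteq> d" for c d
    using part that by (auto simp: partition_on_def disjoint_def)
  have finc: "finite c" if "c \<in> C" for c using sub[OF that] finE by (rule finite_subset)
  have pos: "card c \<ge> 1" if "c \<in> C" for c using bij that by (auto simp: bij_betw_def)
  define B where "B c = (if card c = 1 then c else c - {x c})" for c
  have Bsub: "B c \<subseteq> c" for c by (auto simp: B_def)
  have Bcard: "card (B c) = max 1 (card c - 1)" if "c \<in> C" for c
    using pos[OF that] x[OF that] finc[OF that] by (auto simp: B_def)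
  \<comment> \<open>The classes in \<open>J\<close> have distinct sizes, so their remainders
    together have more than \<open>card J choose 2\<close> edges; a graph of rank below
    \<open>card J\<close> cannot hold that many.\<close>
  have rado_cond: "card J \<le> grank V (\<Union> (B ` J))" if J: "J \<subseteq> C" for J
  proof (cases "J = {}")
    case False
    have finJ: "finite J" using J finC by (rule finite_subset)
    have inj: "inj_on card J" using bij J by (auto simp: bij_betw_def intro: inj_on_subset)
    have "card J choose 2 = card (card ` J) choose 2" using inj by (simp add: card_image)
    also have "\<dots> < (\<Sum>s\<in>card ` J. max 1 (s - 1))"
    proof (rule choose_two_less_sum)
      show "0 \<notin> card ` J" using pos J by fastforce
    qed (use finJ False in auto)
    also have "\<dots> = (\<Sum>c\<in>J. card (B c))"
      using inj Bcard J by (subst sum.reindex) (auto intro!: sum.cong)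
    also have "\<dots> = card (\<Union> (B ` J))"
    proof (rule card_UN_disjoint[symmetric, OF finJ])
      show "\<forall>c\<in>J. finite (B c)" using J finc Bsub by (meson finite_subset subsetD)
      show "\<forall>c\<in>J. \<forall>d\<in>J. c \<noteq> d \<longrightarrow> B c \<inter> B d = {}" using J disj Bsub by blast
    qed
    also have "\<dots> \<le> (grank V (\<Union> (B ` J)) + 1) choose 2"
      using V J sub Bsub by (intro card_le_choose_grank) blast+
    finally have "card J choose 2 < (grank V (\<Union> (B ` J)) + 1) choose 2" .
    then show ?thesis using binomial_right_mono[of "grank V (\<Union> (B ` J)) + 1" "card J" 2]
      by linarith
  qed simp
  have "\<exists>t. (\<forall>c\<in>C. t c \<in> B c) \<and> card C \<le> grank V (t ` C)"
  proof (rule rado[where E = ?E])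
    show "finite (B c)" if "c \<in> C" for c using finc[OF that] Bsub finite_subset by metis
  qed (use V sub Bsub finC rado_cond in \<open>auto intro: grank_submodular grank_mono\<close>)
  then obtain t where t: "\<And>c. c \<in> C \<Longrightarrow> t c \<in> B c" and rank: "n \<le> grank V (t ` C)"
    using cardC by blast
  have tc: "t c \<in> c" if "c \<in> C" for c using t[OF that] Bsub by blast
  have uniq: "d = c" if "c \<in> C" "d \<in> C" "t d \<in> c" for c d
    using disj[OF that(1,2)] tc[OF that(2)] that(3) by blast
  \<comment> \<open>An image of \<open>C\<close> has at most \<open>n\<close> edges, and the
    transversal has rank at least \<open>n\<close>.\<close>
  have "spanning_tree V ?E (t ` C)"
    using V rank cardC card_image_le[OF finC, of t] tc sub
    by (intro spanning_tree_if_grank[where n = n]) auto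
  moreover have "heterochromatic C (t ` C)"
    using uniq unfolding heterochromatic_def by blast
  moreover have "x c \<notin> t ` C" if "c \<in> C" "card c \<noteq> 1" for c
  proof
    assume "x c \<in> t ` C"
    then obtain d where "d \<in> C" "x c = t d" by blast
    with uniq[OF that(1)] x[OF that(1)] have "x c = t c" by metis
    with t[OF that(1)] that(2) show False by (simp add: B_def)
  qed
  ultimately show ?thesis using tc by (intro exI[of _ "t ` C"]) (auto simp: complete_edges_def)
qed

subsection \<open>The adversary\<close>

text \<open>Averaging: each \<open>T\<close> misses at most \<open>card A - 1\<close> elements of
  \<open>A\<close>, so some element is missed by at most the average number of sets. The fraction is
  multiplied out to stay in the naturals.\<close>

lemma popular_element:
  assumes "finite F" "finite A" "A \<noteq> {}" "\<And>T. T \<in> F \<Longrightarrow> T \<inter> A \<noteq> {}"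
  shows "\<exists>a\<in>A. card A * card {T \<in> F. a \<notin> T} \<le> (card A - 1) * card F"
proof (rule ccontr)
  assume "\<not> ?thesis"
  then have *: "(card A - 1) * card F < card A * card {T \<in> F. a \<notin> T}" if "a \<in> A" for a
    using that by (meson not_less)
  have pos: "card A > 0" using assms by (simp add: card_gt_0_iff)
  \<comment> \<open>Count the pairs \<open>(a, T)\<close> with \<open>a \<notin> T\<close> in both
    orders.\<close>
  have "(\<Sum>a\<in>A. card {T \<in> F. a \<notin> T}) = (\<Sum>T\<in>F. card {a \<in> A. a \<notin> T})"
    using assms sum.swap_restrict[of A F "\<lambda>_ _. 1::nat" "\<lambda>a T. a \<notin> T"] by simp
  also have "\<dots> \<le> (\<Sum>T\<in>F. card A - 1)"
  proof (rule sum_mono)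
    fix T assume "T \<in> F"
    then have "{a \<in> A. a \<notin> T} \<subset> A" using assms(4) by blast
    then show "card {a \<in> A. a \<notin> T} \<le> card A - 1"
      using psubset_card_mono[OF assms(2)] by (metis Suc_pred' less_Suc_eq_le pos)
  qed
  finally have le: "(\<Sum>a\<in>A. card {T \<in> F. a \<notin> T}) \<le> (card A - 1) * card F" by (simp add: mult.commute)
  have "(\<Sum>a\<in>A. (card A - 1) * card F) < (\<Sum>a\<in>A. card A * card {T \<in> F. a \<notin> T})"
    using assms * by (intro sum_strict_mono) auto
  also have "\<dots> = card A * (\<Sum>a\<in>A. card {T \<in> F. a \<notin> T})" by (simp add: sum_distrib_left)
  finally show False using le pos by simp
qed

text \<open>The survival fractions telescope: if \<open>q\<close> times the number of survivors is
  at most \<open>card F\<close>, the popular element of a set of size \<open>q + 1\<close> leaves at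
  most \<open>q / (q + 1)\<close> of them. The induction starts at \<open>q = 1\<close>, where
  nothing is deleted.\<close>

lemma adversary_popular:
  assumes "finite F" "1 \<le> q"
    and "\<And>i. i \<in> {2..q} \<Longrightarrow> card (A i) = i"
    and "\<And>i T. i \<in> {2..q} \<Longrightarrow> T \<in> F \<Longrightarrow> T \<inter> A i \<noteq> {}"
  shows "\<exists>x. (\<forall>i\<in>{2..q}. x i \<in> A i) \<and> q * card {T \<in> F. \<forall>i\<in>{2..q}. x i \<notin> T} \<le> card F"
  using assms(2-)
proof (induction q rule: dec_induct)
  case (step q)
  from step.IH step.prems obtain x where x: "\<forall>i\<in>{2..q}. x i \<in> A i"
    "q * card {T \<in> F. \<forall>i\<in>{2..q}. x i \<notin> T} \<le> card F" by auto
  let ?G = "{T \<in> F. \<forall>i\<in>{2..q}. x i \<notin> T}"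
  have card: "card (A (Suc q)) = Suc q" using step by simp
  then have fin: "finite (A (Suc q))" "A (Suc q) \<noteq> {}" by (auto intro: card_ge_0_finite)
  have "\<exists>a\<in>A (Suc q). card (A (Suc q)) * card {T \<in> ?G. a \<notin> T} \<le> (card (A (Suc q)) - 1) * card ?G"
    by (rule popular_element) (use assms(1) fin step in auto)
  then obtain a where a: "a \<in> A (Suc q)" "Suc q * card {T \<in> ?G. a \<notin> T} \<le> q * card ?G"
    using card by auto
  have "{2..Suc q} = insert (Suc q) {2..q}" using step by auto
  then have "{T \<in> F. \<forall>i\<in>{2..Suc q}. (x(Suc q := a)) i \<notin> T} = {T \<in> ?G. a \<notin> T}" by auto
  then have "Suc q * card {T \<in> F. \<forall>i\<in>{2..Suc q}. (x(Suc q := a)) i \<notin> T} \<le> card F"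
    using a(2) x(2) by simp
  moreover have "\<forall>i\<in>{2..Suc q}. (x(Suc q := a)) i \<in> A i" using x(1) a(1) by auto
  ultimately show ?case by blast
qed auto

text \<open>Assign the members of \<open>G\<close> injectively to indices. At its own index each
  \<open>T\<close> is hit by an element of \<open>T\<close>; at unassigned indices any element will
  do.\<close>

lemma adversary_each:
  assumes "finite I" "finite G" "card G \<le> card I"
    and "\<And>i. i \<in> I \<Longrightarrow> A i \<noteq> {}"
    and "\<And>i T. i \<in> I \<Longrightarrow> T \<in> G \<Longrightarrow> T \<inter> A i \<noteq> {}"
  shows "\<exists>x. (\<forall>i\<in>I. x i \<in> A i) \<and> (\<forall>T\<in>G. \<exists>i\<in>I. x i \<in> T)"
proof -
  obtain f where f: "inj_on f G" "f ` G \<subseteq> I"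
    using card_le_inj[OF assms(2,1,3)] by auto
  have "\<exists>a\<in>A i. \<forall>T\<in>G. f T = i \<longrightarrow> a \<in> T" if i: "i \<in> I" for i
  proof (cases "i \<in> f ` G")
    case True
    then obtain T where T: "T \<in> G" "f T = i" by blast
    then obtain a where "a \<in> T" "a \<in> A i" using assms(5)[OF i] by blast
    with T f(1) show ?thesis by (auto dest: inj_onD)
  next
    case False
    then show ?thesis using assms(4)[OF i] by blast
  qed
  then obtain x where "\<And>i. i \<in> I \<Longrightarrow> x i \<in> A i \<and> (\<forall>T\<in>G. f T = i \<longrightarrow> x i \<in> T)" by metis
  with f(2) show ?thesis by (intro exI[of _ x]) blast
qed

text \<open>If \<open>F\<close> were smaller, popular choices in the sets of sizes 2 to
  \<open>q\<close> would leave at most \<open>n - q\<close> members, and the other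
  \<open>n - q\<close> sets could destroy these one by one. Choices begin at size 2 because the
  singleton class is spared.\<close>

lemma card_ge_if_avoiding:
  assumes fin: "finite F" and q: "1 \<le> q" "q \<le> n"
    and cardA: "\<And>i. i \<in> {1..n} \<Longrightarrow> card (A i) = i"
    and meet: "\<And>i T. i \<in> {1..n} \<Longrightarrow> T \<in> F \<Longrightarrow> T \<inter> A i \<noteq> {}"
    and avoid: "\<And>x. (\<And>i. i \<in> {2..n} \<Longrightarrow> x i \<in> A i) \<Longrightarrow> \<exists>T\<in>F. \<forall>i\<in>{2..n}. x i \<notin> T"
  shows "q * (n + 1 - q) \<le> card F"
proof (rule ccontr)
  assume "\<not> ?thesis"
  then have small: "card F < q * (n + 1 - q)" by simp
  have "\<exists>x. (\<forall>i\<in>{2..q}. x i \<in> A i) \<and> q * card {T \<in> F. \<forall>i\<in>{2..q}. x i \<notin> T} \<le> card F"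
    using fin q cardA meet by (intro adversary_popular) auto
  then obtain x where x: "\<And>i. i \<in> {2..q} \<Longrightarrow> x i \<in> A i"
    and le: "q * card {T \<in> F. \<forall>i\<in>{2..q}. x i \<notin> T} \<le> card F" by blast
  define G where "G = {T \<in> F. \<forall>i\<in>{2..q}. x i \<notin> T}"
  have "q * card G < q * (n + 1 - q)"
    unfolding G_def using le small by (rule le_less_trans)
  then have "card G < n + 1 - q" by simp
  then have G: "card G \<le> card {Suc q..n}" using q by auto
  have ne: "A i \<noteq> {}" if "i \<in> {Suc q..n}" for i using cardA[of i] that by auto
  have "\<exists>y. (\<forall>i\<in>{Suc q..n}. y i \<in> A i) \<and> (\<forall>T\<in>G. \<exists>i\<in>{Suc q..n}. y i \<in> T)"
    by (rule adversary_each) (use fin G ne meet q in \<open>auto simp: G_def\<close>)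
  then obtain y where y: "\<And>i. i \<in> {Suc q..n} \<Longrightarrow> y i \<in> A i"
    "\<And>T. T \<in> G \<Longrightarrow> \<exists>i\<in>{Suc q..n}. y i \<in> T" by blast
  define z where "z i = (if i \<le> q then x i else y i)" for i
  have "\<exists>T\<in>F. \<forall>i\<in>{2..n}. z i \<notin> T" using x y(1) by (intro avoid) (auto simp: z_def)
  then obtain T where T: "T \<in> F" "\<And>i. i \<in> {2..n} \<Longrightarrow> z i \<notin> T" by blast
  have "x i \<notin> T" if "i \<in> {2..q}" for i using T(2)[of i] that q by (simp add: z_def)
  then have "T \<in> G" using T(1) by (simp add: G_def)
  then obtain i where "i \<in> {Suc q..n}" "y i \<in> T" using y(2) by blast
  with T(2)[of i] q show False by (simp add: z_def)
qed

theorem theorem2: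
  fixes n :: nat and V :: "'a set" and C :: "'a set set set"
  assumes "n \<ge> 1"
    and "finite V" and "card V = n + 1"
    and "nice_colouring n (complete_edges V) C"
  shows "\<lceil>(real n + 1) / 2\<rceil> * \<lfloor>(real n + 1) / 2\<rfloor>
      \<le> int (card {T. spanning_tree V (complete_edges V) T \<and> heterochromatic C T})"
proof -
  let ?R = "{T. spanning_tree V (complete_edges V) T \<and> heterochromatic C T}"
  \<comment> \<open>Meeting every class, as the averaging requires, is built into \<open>F\<close>;
    the bound passes to \<open>?R\<close> by inclusion.\<close>
  define F where "F = {T \<in> ?R. \<forall>c\<in>C. T \<inter> c \<noteq> {}}"
  define A where "A = inv_into C card"
  have bij: "bij_betw card C {1..n}" using assms(4) by (simp add: nice_colouring_def)
  have AC: "A i \<in> C" and cardA: "card (A i) = i" if "i \<in> {1..n}" for i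
    using bij that by (auto simp: A_def bij_betw_def inv_into_into f_inv_into_f)
  have Acard: "A (card c) = c" if "c \<in> C" for c
    using bij that by (simp add: A_def bij_betw_def)
  have cardC: "card c \<in> {1..n}" if "c \<in> C" for c using bij that by (auto simp: bij_betw_def)
  have "?R \<subseteq> Pow ([V]\<^bsup>2\<^esup>)" by (auto simp: spanning_tree_def complete_edges_def)
  then have finR: "finite ?R" using assms(2) by (meson finite_Pow_iff finite_imp_finite_nsets finite_subset)
  then have finF: "finite F" unfolding F_def by (rule rev_finite_subset) auto
  \<comment> \<open>This is the ceiling of \<open>(n + 1) / 2\<close>, so \<open>n + 1 - q\<close>
    is the floor; this balanced choice maximises \<open>q * (n + 1 - q)\<close>.\<close>
  define q where "q = (n + 2) div 2"
  have "q * (n + 1 - q) \<le> card F"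
  proof (rule card_ge_if_avoiding[where A = A])
    fix x assume x: "\<And>i. i \<in> {2..n} \<Longrightarrow> x i \<in> A i"
    \<comment> \<open>The adversary chooses by size, the tree lemma by class. For the singleton
      class \<open>x\<close> promises nothing, so the default supplies the required member of the
      class.\<close>
    define y where "y c = (if card c = 1 then SOME e. e \<in> c else x (card c))" for c
    have "y c \<in> c" if "c \<in> C" for c
    proof (cases "card c = 1")
      case True
      then show ?thesis by (auto simp: y_def card_1_singleton_iff)
    next
      case False
      then show ?thesis using x[of "card c"] cardC[OF that] Acard[OF that] by (simp add: y_def)
    qed
    from rainbow_tree_avoiding[OF assms(2-4) this] obtain T where "T \<in> F"
      and T: "\<And>c. c \<in> C \<Longrightarrow> card c \<noteq> 1 \<Longrightarrow> y c \<notin> T"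
      by (auto simp: F_def)
    have "x i \<notin> T" if "i \<in> {2..n}" for i
      using T[of "A i"] AC[of i] cardA[of i] that by (simp add: y_def)
    with \<open>T \<in> F\<close> show "\<exists>T\<in>F. \<forall>i\<in>{2..n}. x i \<notin> T" by blast
  qed (use finF assms(1) cardA AC in \<open>auto simp: F_def q_def\<close>)
  also have "card F \<le> card ?R" using finR by (intro card_mono) (auto simp: F_def)
  finally have "q * (n + 1 - q) \<le> card ?R" .
  then have "int q * int (n + 1 - q) \<le> int (card ?R)" by (metis of_nat_le_iff of_nat_mult)
  moreover have "\<lceil>(real n + 1) / 2\<rceil> = int q" "\<lfloor>(real n + 1) / 2\<rfloor> = int (n + 1 - q)"
    unfolding q_def by (cases "even n"; auto elim!: evenE oddE simp: ceiling_eq_iff floor_eq_iff)+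
  ultimately show ?thesis by simp
qed

end
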